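(* Let $\alpha$ be a unit speed curve in the Lie group $SU(2)$, with a bi-invariant metric $\langle\,,\rangle$ for which $\tau_G=1$, with Frenet frame $\{T,N,B\}$, curvature $\varkappa$ and torsion $\tau$. Then $\alpha$ is a slant helix if and only if $$\sigma_N=\frac{\left(\varkappa^2+(\tau-1)^2\right)^{3/2}}{\varkappa^2\left(\frac{\tau-1}{\varkappa}\right)'}$$ is a constant function (which includes that $\left(\frac{\tau-1}{\varkappa}\right)'$ vanishes nowhere, so that the quotient is defined).
   Context: $G=SU(2)$ (written $SU^2$ or $S^3$ in the paper), $\mathfrak{g}$ is its Lie algebra of left-invariant vector fields and $D$ is the Levi-Civita connection, so $D_XY=\frac12[X,Y]$ for $X,Y\in\mathfrak{g}$. Let $\{X_1,X_2,X_3\}$ be an orthonormal basis of $\mathfrak{g}$. Vector fields along $\alpha$ are written $W=\sum_i w_iX_i$ with smooth $w_i$; one sets $\dot W=\sum_i w_i'X_i$, brackets are extended bilinearly over functions, and $D_{\alpha'}W=\dot W+\frac12[T,W]$ with $T=\alpha'$. The Frenet apparatus of a unit speed curve consists of the positively oriented orthonormal frame $T=\alpha',N,B=T\times N$, the curvature $\varkappa=\|\dot T\|>0$ and the torsion $\tau$, with $D_TT=\varkappa N$, $D_TN=-\varkappa T+\tau B$, $D_TB=-\tau N$. One sets $\tau_G=\frac12\langle[T,N],B\rangle$; the metric and orientation on $SU(2)$ are normalized so that $\tau_G=1$ for every such curve (i.e. $[X_1,X_2]=2X_3$ and cyclically, for a positively oriented orthonormal basis of $\mathfrak{g}$). Prime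 denotes differentiation with respect to the arc length $s$. Slant helix: $\alpha$ is a slant helix if there is a unit length left-invariant vector field $X\in\mathfrak{g}$ and a constant angle $\theta\ne\frac{\pi}{2}$ such that $\langle N(s),X\rangle=\cos\theta$ for all $s$. *)

theory Defs
  imports "HOL-Analysis.Analysis"
begin

section \<open>The Lie group \<open>SU(2)\<close> and its left-invariant vector fields\<close>

type_synonym cmat2 = "complex ^ 2 ^ 2"

text \<open>Vector fields on \<open>SU(2)\<close> and Riemannian metrics on \<open>SU(2)\<close> are represented by functions on
  all matrices; only their values at points of \<open>SU(2)\<close> and on tangent vectors there are ever used.\<close>

type_synonym vfield = "cmat2 \<Rightarrow> cmat2"
type_synonym metric = "cmat2 \<Rightarrow> cmat2 \<Rightarrow> cmat2 \<Rightarrow> real"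

definition ctranspose :: "cmat2 \<Rightarrow> cmat2" where
  "ctranspose A = (\<chi> i j. cnj (A $ j $ i))"

definition SU2 :: "cmat2 set" where
  "SU2 = {A. A ** ctranspose A = mat 1 \<and> det A = 1}"

definition su2 :: "cmat2 set" where
  "su2 = {A. ctranspose A = - A \<and> trace A = 0}"

definition tangent_SU2 :: "cmat2 \<Rightarrow> cmat2 set" where
  "tangent_SU2 p = (\<lambda>A. p ** A) ` su2"

definition left_invariant :: "vfield \<Rightarrow> bool" where
  "left_invariant X \<longleftrightarrow>
     (\<forall>p\<in>SU2. X p \<in> tangent_SU2 p) \<and> (\<forall>p\<in>SU2. \<forall>q\<in>SU2. X (p ** q) = p ** X q)"

text \<open>The bracket of left-invariant fields. A left-invariant \<open>X\<close> is the restriction of the linear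
  field \<open>p \<mapsto> p ** X (mat 1)\<close>, and the vector field commutator \<open>D Y (X) - D X (Y)\<close> of two such linear
  fields is the expression below.\<close>

definition lie_bracket :: "vfield \<Rightarrow> vfield \<Rightarrow> vfield" where
  "lie_bracket X Y p = p ** (X (mat 1) ** Y (mat 1) - Y (mat 1) ** X (mat 1))"

text \<open>Smoothness of the metric in the base point is not listed, since it follows from
  left-invariance.\<close>

definition bi_invariant_metric :: "metric \<Rightarrow> bool" where
  "bi_invariant_metric g \<longleftrightarrow>
     (\<forall>p\<in>SU2. \<forall>u\<in>tangent_SU2 p. \<forall>v\<in>tangent_SU2 p. \<forall>w\<in>tangent_SU2 p. \<forall>a b :: real.
        g p (a *\<^sub>R u + b *\<^sub>R v) w = a * g p u w + b * g p v w) \<and>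
     (\<forall>p\<in>SU2. \<forall>v\<in>tangent_SU2 p. \<forall>w\<in>tangent_SU2 p. g p v w = g p w v) \<and>
     (\<forall>p\<in>SU2. \<forall>v\<in>tangent_SU2 p. v \<noteq> 0 \<longrightarrow> 0 < g p v v) \<and>
     (\<forall>p\<in>SU2. \<forall>q\<in>SU2. \<forall>v\<in>tangent_SU2 p. \<forall>w\<in>tangent_SU2 p.
        g (q ** p) (q ** v) (q ** w) = g p v w \<and> g (p ** q) (v ** q) (w ** q) = g p v w)"

definition orthonormal_frame :: "metric \<Rightarrow> (3 \<Rightarrow> vfield) \<Rightarrow> bool" where
  "orthonormal_frame g E \<longleftrightarrow>
     (\<forall>i. left_invariant (E i)) \<and>
     (\<forall>p\<in>SU2. \<forall>i j. g p (E i p) (E j p) = (if i = j then 1 else 0))"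

section \<open>Vector fields along a curve\<close>

text \<open>A vector field along a curve \<open>\<alpha>\<close> is a function \<open>W\<close> with \<open>W s\<close> tangent to \<open>SU(2)\<close> at \<open>\<alpha> s\<close>.
  Throughout, \<open>E\<close> is an orthonormal basis of the Lie algebra, and it also serves to fix the
  orientation: \<open>E 1, E 2, E 3\<close> is declared to be positively oriented.\<close>

definition coords :: "metric \<Rightarrow> (3 \<Rightarrow> vfield) \<Rightarrow> (real \<Rightarrow> cmat2) \<Rightarrow> (real \<Rightarrow> cmat2) \<Rightarrow> real \<Rightarrow> real ^ 3" where
  "coords g E \<alpha> W s = (\<chi> i. g (\<alpha> s) (W s) (E i (\<alpha> s)))"

definition dot_along :: "metric \<Rightarrow> (3 \<Rightarrow> vfield) \<Rightarrow> (real \<Rightarrow> cmat2) \<Rightarrow> (real \<Rightarrow> cmat2) \<Rightarrow> real \<Rightarrow> cmat2" where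
  "dot_along g E \<alpha> W s = (\<Sum>i\<in>UNIV. deriv (\<lambda>t. coords g E \<alpha> W t $ i) s *\<^sub>R E i (\<alpha> s))"

definition bracket_along ::
    "metric \<Rightarrow> (3 \<Rightarrow> vfield) \<Rightarrow> (real \<Rightarrow> cmat2) \<Rightarrow> (real \<Rightarrow> cmat2) \<Rightarrow> (real \<Rightarrow> cmat2) \<Rightarrow> real \<Rightarrow> cmat2" where
  "bracket_along g E \<alpha> V W s =
     (\<Sum>i\<in>UNIV. \<Sum>j\<in>UNIV. (coords g E \<alpha> V s $ i * coords g E \<alpha> W s $ j) *\<^sub>R lie_bracket (E i) (E j) (\<alpha> s))"

definition cross_along ::
    "metric \<Rightarrow> (3 \<Rightarrow> vfield) \<Rightarrow> (real \<Rightarrow> cmat2) \<Rightarrow> (real \<Rightarrow> cmat2) \<Rightarrow> (real \<Rightarrow> cmat2) \<Rightarrow> real \<Rightarrow> cmat2" where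
  "cross_along g E \<alpha> V W s =
     (\<Sum>i\<in>UNIV. cross3 (coords g E \<alpha> V s) (coords g E \<alpha> W s) $ i *\<^sub>R E i (\<alpha> s))"

definition smooth_curve_on :: "real set \<Rightarrow> (real \<Rightarrow> cmat2) \<Rightarrow> bool" where
  "smooth_curve_on I \<alpha> \<longleftrightarrow>
     (\<forall>n. \<forall>s\<in>I. ((\<lambda>f t. vector_derivative f (at t)) ^^ n) \<alpha> differentiable (at s))"

definition Tan :: "(real \<Rightarrow> cmat2) \<Rightarrow> real \<Rightarrow> cmat2" where
  "Tan \<alpha> s = vector_derivative \<alpha> (at s)"

text \<open>The Levi-Civita derivative along \<open>\<alpha>\<close>: for a bi-invariant metric \<open>D\<^sub>X Y = [X, Y] / 2\<close> on
  left-invariant fields, and the Leibniz rule contributes \<open>dot_along\<close>.\<close>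

definition cov_deriv :: "metric \<Rightarrow> (3 \<Rightarrow> vfield) \<Rightarrow> (real \<Rightarrow> cmat2) \<Rightarrow> (real \<Rightarrow> cmat2) \<Rightarrow> real \<Rightarrow> cmat2" where
  "cov_deriv g E \<alpha> W s = dot_along g E \<alpha> W s + (1/2) *\<^sub>R bracket_along g E \<alpha> (Tan \<alpha>) W s"

definition unit_speed_curve :: "metric \<Rightarrow> real set \<Rightarrow> (real \<Rightarrow> cmat2) \<Rightarrow> bool" where
  "unit_speed_curve g I \<alpha> \<longleftrightarrow>
     smooth_curve_on I \<alpha> \<and> (\<forall>s\<in>I. \<alpha> s \<in> SU2) \<and> (\<forall>s\<in>I. g (\<alpha> s) (Tan \<alpha> s) (Tan \<alpha> s) = 1)"

section \<open>Frenet apparatus and slant helices\<close>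

definition curvature :: "metric \<Rightarrow> (3 \<Rightarrow> vfield) \<Rightarrow> (real \<Rightarrow> cmat2) \<Rightarrow> real \<Rightarrow> real" where
  "curvature g E \<alpha> s = sqrt (g (\<alpha> s) (dot_along g E \<alpha> (Tan \<alpha>) s) (dot_along g E \<alpha> (Tan \<alpha>) s))"

definition Nor :: "metric \<Rightarrow> (3 \<Rightarrow> vfield) \<Rightarrow> (real \<Rightarrow> cmat2) \<Rightarrow> real \<Rightarrow> cmat2" where
  "Nor g E \<alpha> s = (1 / curvature g E \<alpha> s) *\<^sub>R cov_deriv g E \<alpha> (Tan \<alpha>) s"

definition Bin :: "metric \<Rightarrow> (3 \<Rightarrow> vfield) \<Rightarrow> (real \<Rightarrow> cmat2) \<Rightarrow> real \<Rightarrow> cmat2" where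
  "Bin g E \<alpha> = cross_along g E \<alpha> (Tan \<alpha>) (Nor g E \<alpha>)"

text \<open>The torsion is read off from the Frenet equation \<open>D\<^sub>T N = - \<kappa> T + \<tau> B\<close>.\<close>

definition torsion :: "metric \<Rightarrow> (3 \<Rightarrow> vfield) \<Rightarrow> (real \<Rightarrow> cmat2) \<Rightarrow> real \<Rightarrow> real" where
  "torsion g E \<alpha> s = g (\<alpha> s) (cov_deriv g E \<alpha> (Nor g E \<alpha>) s) (Bin g E \<alpha> s)"

definition tau_G :: "metric \<Rightarrow> (3 \<Rightarrow> vfield) \<Rightarrow> (real \<Rightarrow> cmat2) \<Rightarrow> real \<Rightarrow> real" where
  "tau_G g E \<alpha> s = (1/2) * g (\<alpha> s) (bracket_along g E \<alpha> (Tan \<alpha>) (Nor g E \<alpha>) s) (Bin g E \<alpha> s)"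

definition slant_helix :: "metric \<Rightarrow> (3 \<Rightarrow> vfield) \<Rightarrow> real set \<Rightarrow> (real \<Rightarrow> cmat2) \<Rightarrow> bool" where
  "slant_helix g E I \<alpha> \<longleftrightarrow>
     (\<exists>X \<theta>. left_invariant X \<and> (\<forall>p\<in>SU2. g p (X p) (X p) = 1) \<and>
        0 \<le> \<theta> \<and> \<theta> \<le> pi \<and> \<theta> \<noteq> pi / 2 \<and>
        (\<forall>s\<in>I. g (\<alpha> s) (Nor g E \<alpha> s) (X (\<alpha> s)) = cos \<theta>))"

text \<open>The harmonic curvature \<open>(\<tau> - \<tau>\<^sub>G) / \<kappa>\<close> and \<open>\<sigma>\<^sub>N\<close>, both for \<open>\<tau>\<^sub>G = 1\<close>. In \<open>sigma_N\<close>, division by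
  zero has to be excluded separately.\<close>

definition harmonic :: "metric \<Rightarrow> (3 \<Rightarrow> vfield) \<Rightarrow> (real \<Rightarrow> cmat2) \<Rightarrow> real \<Rightarrow> real" where
  "harmonic g E \<alpha> s = (torsion g E \<alpha> s - 1) / curvature g E \<alpha> s"

definition sigma_N :: "metric \<Rightarrow> (3 \<Rightarrow> vfield) \<Rightarrow> (real \<Rightarrow> cmat2) \<Rightarrow> real \<Rightarrow> real" where
  "sigma_N g E \<alpha> s =
     ((curvature g E \<alpha> s)\<^sup>2 + (torsion g E \<alpha> s - 1)\<^sup>2) powr (3/2) /
     ((curvature g E \<alpha> s)\<^sup>2 * deriv (harmonic g E \<alpha>) s)"

end

theory Submission
  imports Defs
begin

text \<open>Left translation trivialises the tangent bundle of \<open>SU(2)\<close>: a field along the curve is the same as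
  a curve of coordinate vectors in \<open>\<real>\<^sup>3\<close> with respect to the left-invariant frame, and left-invariant
  unit fields are the constant unit vectors. The covariant derivative is the ordinary derivative plus
  half a bracket with \<open>T\<close>. The bracket vanishes on \<open>T\<close> itself, so the curvature is unaffected, and it
  contributes exactly \<open>\<tau>\<^sub>G = 1\<close> to the torsion. In coordinates the frame \<open>u, n, b\<close> therefore satisfies
  the Euclidean Frenet equations
  \<open>u' = k n\<close>, \<open>n' = t b - k u\<close>, \<open>b' = - t n\<close> with \<open>k = \<kappa>\<close> and \<open>t = \<tau> - 1\<close>,
  and the assertion becomes the characterisation of slant helices in Euclidean space.

  For that, let \<open>h = t / k\<close> and \<open>w = sqrt (1 + h\<^sup>2)\<close>, so that \<open>\<sigma> = k w\<^sup>3 / h'\<close>. A vector \<open>d\<close> with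
  \<open>\<langle>n, d\<rangle> = c \<noteq> 0\<close> constant has \<open>\<langle>u, d\<rangle> = h \<langle>b, d\<rangle>\<close>; its component \<open>\<langle>b, d\<rangle> w\<close> along the unit vector
  \<open>(h u + b) / w\<close> is constant and equals \<open>c \<sigma>\<close> (\<open>sigma_const_if_slant\<close>). Conversely, if \<open>\<sigma> = m\<close> is
  constant, then \<open>n + m (h u + b) / w\<close> is a constant vector and serves as the axis
  (\<open>slant_if_sigma_const\<close>). On the side of the group this needs that the velocity of a curve in
  \<open>SU(2)\<close> is tangent (\<open>velocity_tangent\<close>), that the frame spans the tangent spaces (\<open>range_comb\<close>), and
  that coordinates depend smoothly on the parameter (\<open>exists_linear_coords\<close>).\<close>

section \<open>Slant helices in Euclidean space\<close>

lemma unit_cross3: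
  fixes u n :: "real ^ 3"
  assumes "u \<bullet> u = 1" "n \<bullet> n = 1" "u \<bullet> n = 0"
  shows "cross3 u n \<bullet> cross3 u n = 1"
proof -
  have "norm u = 1" "norm n = 1"
    using assms by (simp_all add: norm_eq_1)
  then show ?thesis
    using norm_cross_dot[of u n] assms(3) by (simp add: power2_norm_eq_inner)
qed

text \<open>Crossing twice with the unit vector \<open>b = u \<times> n\<close> is minus the projection onto the plane of \<open>u\<close> and \<open>n\<close>, and Lagrange's identity computes
  it in terms of \<open>u\<close> and \<open>n\<close>.\<close>

lemma orthonormal_expansion_R3:
  fixes u n v :: "real ^ 3"
  assumes "u \<bullet> u = 1" "n \<bullet> n = 1" "u \<bullet> n = 0"
  shows "v = (v \<bullet> u) *\<^sub>R u + (v \<bullet> n) *\<^sub>R n + (v \<bullet> cross3 u n) *\<^sub>R cross3 u n"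
proof -
  define b where "b = cross3 u n"
  have bb: "b \<bullet> b = 1"
    unfolding b_def by (rule unit_cross3) (fact assms)+
  have nb: "cross3 n b = u" and bu: "cross3 b u = n"
    using assms cross_skew[of b u] by (simp_all add: b_def Lagrange inner_commute)
  have bv: "cross3 b v = (v \<bullet> u) *\<^sub>R n - (v \<bullet> n) *\<^sub>R u"
    using cross_skew[of b v] by (simp add: b_def Lagrange inner_commute)
  have "cross3 b (cross3 b v) = (b \<bullet> v) *\<^sub>R b - v"
    using bb by (simp add: Lagrange)
  moreover have "cross3 b (cross3 b v) = - (v \<bullet> u) *\<^sub>R u - (v \<bullet> n) *\<^sub>R n"
    unfolding bv using cross_skew[of b n] nb bu
    by (simp add: Cross3.right_diff_distrib cross_mult_right)
  ultimately show ?thesis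
    unfolding b_def[symmetric] by (simp add: inner_commute algebra_simps)
qed

lemma bounded_bilinear_cross3: "bounded_bilinear cross3"
  using bilinear_cross by (simp add: bilinear_conv_bounded_bilinear)

text \<open>A unit speed curve in Euclidean space is represented by its Frenet frame, with \<open>k\<close> as curvature and
  \<open>t\<close> as torsion. The only derivative that enters \<open>\<sigma>\<close> is that of the ratio \<open>t / k\<close>, whence the form of the
  last assumption.\<close>

locale frenet_curve =
  fixes I :: "real set" and u n b :: "real \<Rightarrow> real ^ 3" and k t h' :: "real \<Rightarrow> real"
  assumes open_I: "open I" and interval_I: "is_interval I" and I_nonempty: "I \<noteq> {}"
    and unit_u: "s \<in> I \<Longrightarrow> u s \<bullet> u s = 1"
    and unit_n: "s \<in> I \<Longrightarrow> n s \<bullet> n s = 1"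
    and orth: "s \<in> I \<Longrightarrow> u s \<bullet> n s = 0"
    and b_eq: "s \<in> I \<Longrightarrow> b s = cross3 (u s) (n s)"
    and k_pos: "s \<in> I \<Longrightarrow> 0 < k s"
    and deriv_u: "s \<in> I \<Longrightarrow> (u has_vector_derivative k s *\<^sub>R n s) (at s)"
    and deriv_n: "s \<in> I \<Longrightarrow> (n has_vector_derivative t s *\<^sub>R b s - k s *\<^sub>R u s) (at s)"
    and deriv_ratio: "s \<in> I \<Longrightarrow> ((\<lambda>s. t s / k s) has_real_derivative h' s) (at s)"
begin

definition sigma :: "real \<Rightarrow> real" where
  "sigma s = ((k s)\<^sup>2 + (t s)\<^sup>2) powr (3/2) / ((k s)\<^sup>2 * h' s)"

lemma deriv_b:
  assumes s: "s \<in> I"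
  shows "(b has_vector_derivative - t s *\<^sub>R n s) (at s)"
proof -
  have "((\<lambda>s. cross3 (u s) (n s)) has_vector_derivative
      cross3 (u s) (t s *\<^sub>R b s - k s *\<^sub>R u s) + cross3 (k s *\<^sub>R n s) (n s)) (at s)"
    by (rule bounded_bilinear.has_vector_derivative[OF bounded_bilinear_cross3 deriv_u[OF s] deriv_n[OF s]])
  moreover have "cross3 (u s) (b s) = - n s"
    by (simp add: b_eq s Lagrange unit_u orth)
  ultimately have "((\<lambda>s. cross3 (u s) (n s)) has_vector_derivative - t s *\<^sub>R n s) (at s)"
    by (simp add: Cross3.right_diff_distrib cross_mult_right cross_mult_left)
  then show ?thesis
    by (rule has_vector_derivative_transform_within_open[OF _ open_I s]) (simp add: b_eq)
qed

text \<open>Writing \<open>w\<close> for \<open>sqrt (1 + h\<^sup>2)\<close> with \<open>h = t / k\<close> turns the fractional power into a cube, which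
  is the form in which both directions use \<open>\<sigma>\<close>.\<close>

lemma sigma_eq:
  assumes s: "s \<in> I"
  shows "sigma s = k s * (sqrt (1 + (t s / k s)\<^sup>2)) ^ 3 / h' s"
proof -
  let ?w = "sqrt (1 + (t s / k s)\<^sup>2)"
  have w: "0 < ?w"
    by (simp add: add_pos_nonneg)
  have "(k s)\<^sup>2 + (t s)\<^sup>2 = (k s * ?w)\<^sup>2"
    using k_pos[OF s] by (simp add: power_mult_distrib field_simps)
  moreover have "((k s * ?w)\<^sup>2) powr (3/2) = (k s * ?w) ^ 3"
    using k_pos[OF s] w by (simp add: powr_powr flip: powr_numeral)
  ultimately show ?thesis
    using k_pos[OF s] by (simp add: sigma_def power_mult_distrib power3_eq_cube power2_eq_square)
qed

lemma deriv_weight: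
  assumes s: "s \<in> I"
  shows "((\<lambda>s. sqrt (1 + (t s / k s)\<^sup>2)) has_real_derivative
      t s / k s * h' s / sqrt (1 + (t s / k s)\<^sup>2)) (at s)"
proof -
  have "0 < 1 + (t s / k s)\<^sup>2"
    by (simp add: add_pos_nonneg)
  moreover have "((\<lambda>s. 1 + (t s / k s)\<^sup>2) has_real_derivative 2 * (t s / k s) * h' s) (at s)"
    using DERIV_add[OF DERIV_const DERIV_power[OF deriv_ratio[OF s], of 2], of 1]
    by (simp add: mult_ac)
  ultimately show ?thesis
    using DERIV_chain2[OF DERIV_real_sqrt] by (fastforce simp: field_simps)
qed

text \<open>Write \<open>p = \<langle>u, d\<rangle>\<close>, \<open>q = \<langle>b, d\<rangle>\<close> and \<open>h = t / k\<close>. That \<open>\<langle>n, d\<rangle> = c\<close> is constant says \<open>p = h q\<close>.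
  Differentiating this relation gives \<open>h' q = c k (1 + h\<^sup>2)\<close>, which is nonzero, so \<open>h'\<close> cannot vanish.
  It also shows \<open>\<sigma> = q w / c\<close> with \<open>w = sqrt (1 + h\<^sup>2)\<close>. Geometrically \<open>(q w)\<^sup>2 = p\<^sup>2 + q\<^sup>2\<close> is the squared
  length of the part of \<open>d\<close> orthogonal to \<open>n\<close>; computing \<open>(q w)' = 0\<close> directly settles its
  sign as well.\<close>

lemma sigma_const_if_slant:
  assumes c: "c \<noteq> 0" and slant: "\<And>s. s \<in> I \<Longrightarrow> n s \<bullet> d = c"
  shows "(\<forall>s\<in>I. h' s \<noteq> 0) \<and> (\<exists>m. \<forall>s\<in>I. sigma s = m)"
proof -
  define h where "h s = t s / k s" for s
  define p where "p s = u s \<bullet> d" for s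
  define q where "q s = b s \<bullet> d" for s
  define w where "w s = sqrt (1 + (h s)\<^sup>2)" for s
  have w_pos: "0 < w s" and w2: "w s * w s = 1 + (h s)\<^sup>2" for s
    by (simp_all add: w_def add_pos_nonneg)
  have h: "t s = h s * k s" if "s \<in> I" for s
    using k_pos[OF that] by (simp add: h_def)
  have dp: "(p has_real_derivative k s * c) (at s)"
    and dq: "(q has_real_derivative - t s * c) (at s)" if "s \<in> I" for s
    unfolding p_def q_def has_real_derivative_iff_has_vector_derivative
    using bounded_linear.has_vector_derivative[OF bounded_linear_inner_left deriv_u[OF that], of d]
      bounded_linear.has_vector_derivative[OF bounded_linear_inner_left deriv_b[OF that], of d]
    by (simp_all add: slant that)
  have p_eq: "p s = h s * q s" if s: "s \<in> I" for s
  proof -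
    have "((\<lambda>s. n s \<bullet> d) has_vector_derivative t s * q s - k s * p s) (at s)"
      using bounded_linear.has_vector_derivative[OF bounded_linear_inner_left deriv_n[OF s], of d]
      by (simp add: p_def q_def inner_diff_left)
    moreover have "((\<lambda>s. n s \<bullet> d) has_vector_derivative 0) (at s)"
      by (rule has_vector_derivative_transform_within_open[OF has_vector_derivative_const open_I s])
        (simp add: slant)
    ultimately have "t s * q s - k s * p s = 0"
      by (rule vector_derivative_unique_at)
    then show ?thesis
      using k_pos[OF s] by (simp add: h_def field_simps)
  qed
  have key: "h' s * q s = c * k s * (1 + (h s)\<^sup>2)" if s: "s \<in> I" for s
  proof -
    have "((\<lambda>s. h s * q s) has_real_derivative h' s * q s + (- t s * c) * h s) (at s)"
      unfolding h_def by (rule DERIV_mult[OF deriv_ratio[OF s] dq[OF s]])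
    moreover have "((\<lambda>s. h s * q s) has_real_derivative k s * c) (at s)"
      by (rule has_field_derivative_transform_within_open[OF dp[OF s] open_I s]) (simp add: p_eq)
    ultimately have "h' s * q s + (- t s * c) * h s = k s * c"
      by (rule DERIV_unique)
    then show ?thesis
      unfolding h[OF s] by (simp add: algebra_simps power2_eq_square)
  qed
  have nz: "h' s \<noteq> 0" "q s \<noteq> 0" if s: "s \<in> I" for s
  proof -
    have "0 < 1 + (h s)\<^sup>2"
      by (simp add: add_pos_nonneg)
    then have "h' s * q s \<noteq> 0"
      using key[OF s] c k_pos[OF s] by simp
    then show "h' s \<noteq> 0" "q s \<noteq> 0"
      by auto
  qed
  have "((\<lambda>s. q s * w s) has_real_derivative 0) (at s)" if s: "s \<in> I" for s
  proof -
    have "((\<lambda>s. q s * w s) has_real_derivative - t s * c * w s + h s * h' s / w s * q s) (at s)"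
      unfolding w_def h_def by (rule DERIV_mult[OF dq[OF s] deriv_weight[OF s]])
    moreover have "- t s * c * w s + h s * h' s / w s * q s = 0"
    proof -
      have "h s * (h' s * q s) = t s * c * (w s * w s)"
        unfolding key[OF s] w2 h[OF s] by (simp add: algebra_simps)
      then show ?thesis
        using w_pos[of s] by (simp add: field_simps)
    qed
    ultimately show ?thesis
      by simp
  qed
  then have "\<exists>m. \<forall>s\<in>I. q s * w s = m"
    using interval_I
    by (intro has_field_derivative_zero_constant)
      (auto simp: is_interval_convex has_field_derivative_at_within)
  then obtain m where m: "\<And>s. s \<in> I \<Longrightarrow> q s * w s = m"
    by blast
  have "sigma s = m / c" if s: "s \<in> I" for s
  proof -
    have "h' s * q s = c * k s * (w s * w s)"
      using key[OF s] w2 by simp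
    then have "k s * w s ^ 3 / h' s = q s * w s / c"
      using nz[OF s] c by (simp add: field_simps power3_eq_cube)
    then show ?thesis
      using sigma_eq[OF s] m[OF s] by (simp add: w_def h_def)
  qed
  then show ?thesis
    using nz by blast
qed

text \<open>The other direction shows what the axis has to be: if \<open>\<langle>n, d\<rangle>\<close> is a nonzero constant then
  \<open>d\<close>, rescaled to \<open>\<langle>n, d\<rangle> = 1\<close>, is \<open>n + m (h u + b) / w\<close> with \<open>m = \<sigma>\<close>. When \<open>\<sigma> = m\<close> is constant, that is
  \<open>m h' = k w\<^sup>3\<close>, the coefficients of \<open>u\<close> and \<open>b\<close> have derivatives \<open>k\<close> and \<open>- t\<close>, which is exactly what
  makes this vector constant.\<close>

lemma slant_if_sigma_const:
  assumes h'_nz: "\<And>s. s \<in> I \<Longrightarrow> h' s \<noteq> 0" and sig: "\<And>s. s \<in> I \<Longrightarrow> sigma s = m"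
  shows "\<exists>d c. norm d = 1 \<and> 0 < c \<and> c \<le> 1 \<and> (\<forall>s\<in>I. n s \<bullet> d = c)"
proof -
  define h where "h s = t s / k s" for s
  define w where "w s = sqrt (1 + (h s)\<^sup>2)" for s
  have w_pos: "0 < w s" and w2: "w s * w s = 1 + (h s)\<^sup>2" for s
    by (simp_all add: w_def add_pos_nonneg)
  have h: "t s = h s * k s" if "s \<in> I" for s
    using k_pos[OF that] by (simp add: h_def)
  have mh: "m * h' s = k s * w s ^ 3" if s: "s \<in> I" for s
    using sig[OF s] sigma_eq[OF s] h'_nz[OF s] by (simp add: w_def h_def field_simps)
  define x where "x s = m * h s / w s" for s
  define y where "y s = m / w s" for s
  have dh: "(h has_real_derivative h' s) (at s)" if "s \<in> I" for s
    unfolding h_def by (rule deriv_ratio[OF that])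
  have dw: "(w has_real_derivative h s * h' s / w s) (at s)" if "s \<in> I" for s
    unfolding w_def h_def by (rule deriv_weight[OF that])
  have dx: "(x has_real_derivative k s) (at s)" if s: "s \<in> I" for s
  proof -
    have "(x has_real_derivative (m * h' s * w s - m * h s * (h s * h' s / w s)) / (w s * w s)) (at s)"
      unfolding x_def using w_pos[of s] by (auto intro!: derivative_eq_intros dh[OF s] dw[OF s])
    moreover have "(m * h' s * w s - m * h s * (h s * h' s / w s)) / (w s * w s) = k s"
    proof -
      have "m * h' s * w s - m * h s * (h s * h' s / w s) = m * h' s * (w s * w s - (h s)\<^sup>2) / w s"
        using w_pos[of s] by (simp add: field_simps power2_eq_square)
      also have "\<dots> = k s * (w s * w s)"
        using w_pos[of s] by (simp add: w2 mh[OF s] power3_eq_cube)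
      finally show ?thesis
        using w_pos[of s] by simp
    qed
    ultimately show ?thesis by simp
  qed
  have dy: "(y has_real_derivative - t s) (at s)" if s: "s \<in> I" for s
  proof -
    have "(y has_real_derivative - (m * (h s * h' s / w s)) / (w s * w s)) (at s)"
      unfolding y_def using w_pos[of s] by (auto intro!: derivative_eq_intros dw[OF s])
    moreover have "- (m * (h s * h' s / w s)) / (w s * w s) = - (h s * (m * h' s)) / (w s ^ 3)"
      using w_pos[of s] by (simp add: field_simps power3_eq_cube)
    moreover have "\<dots> = - t s"
      using w_pos[of s] by (simp add: mh[OF s] h[OF s])
    ultimately show ?thesis by simp
  qed
  define v where "v s = n s + (x s *\<^sub>R u s + y s *\<^sub>R b s)" for s
  have "(v has_vector_derivative 0) (at s)" if s: "s \<in> I" for s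
  proof -
    have "(v has_vector_derivative (t s *\<^sub>R b s - k s *\<^sub>R u s) +
        ((x s *\<^sub>R (k s *\<^sub>R n s) + k s *\<^sub>R u s) + (y s *\<^sub>R (- t s *\<^sub>R n s) + (- t s) *\<^sub>R b s))) (at s)"
      unfolding v_def
      by (intro has_vector_derivative_add has_vector_derivative_scaleR deriv_n deriv_u deriv_b dx dy s)
    moreover have "x s * k s = y s * t s"
      by (simp add: x_def y_def h[OF s])
    ultimately show ?thesis
      by (simp add: algebra_simps)
  qed
  then have "\<exists>V. \<forall>s\<in>I. v s = V"
    using interval_I
    by (intro has_derivative_zero_constant)
      (auto simp: is_interval_convex has_vector_derivative_def intro: has_derivative_at_withinI)
  then obtain V where V: "\<And>s. s \<in> I \<Longrightarrow> v s = V"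
    by blast
  have nV: "n s \<bullet> V = 1" if s: "s \<in> I" for s
  proof -
    have "n s \<bullet> u s = 0" "n s \<bullet> b s = 0"
      using orth[OF s] by (simp_all add: inner_commute b_eq[OF s] dot_cross_self)
    then have "n s \<bullet> v s = 1"
      using unit_n[OF s] by (simp add: v_def inner_add_right)
    then show ?thesis
      using V[OF s] by simp
  qed
  obtain s0 where s0: "s0 \<in> I"
    using I_nonempty by blast
  have "norm (n s0) = 1"
    using unit_n[OF s0] by (simp add: norm_eq_1)
  then have V1: "1 \<le> norm V"
    using norm_cauchy_schwarz[of "n s0" V] nV[OF s0] by simp
  show ?thesis
    using V1 nV by (intro exI[of _ "V /\<^sub>R norm V"] exI[of _ "1 / norm V"]) (auto simp: field_simps)
qed

end

section \<open>Iterated differentiability on an open set\<close>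

text \<open>Smoothness is differentiability of every finite order; carrying the order \<open>k\<close> as a parameter makes
  closure under products, reciprocals and square roots provable by induction on it. Derivatives are
  only prescribed on \<open>I\<close>, so a function may be changed freely off an open \<open>I\<close>.\<close>

primrec times_diff :: "nat \<Rightarrow> real set \<Rightarrow> (real \<Rightarrow> 'a::real_normed_vector) \<Rightarrow> bool" where
  "times_diff 0 I f = True"
| "times_diff (Suc k) I f =
     (\<exists>f'. (\<forall>s\<in>I. (f has_vector_derivative f' s) (at s)) \<and> times_diff k I f')"

lemma times_diff_SucI:
  "(\<And>s. s \<in> I \<Longrightarrow> (f has_vector_derivative f' s) (at s)) \<Longrightarrow> times_diff k I f' \<Longrightarrow>
    times_diff (Suc k) I f"
  by auto

lemma times_diff_SucD: "times_diff (Suc k) I f \<Longrightarrow> times_diff k I f"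
proof (induction k arbitrary: f)
  case (Suc k)
  then obtain f' where "\<forall>s\<in>I. (f has_vector_derivative f' s) (at s)" "times_diff (Suc k) I f'"
    using times_diff.simps(2)[of "Suc k"] by blast
  then show ?case
    using Suc.IH by auto
qed simp

lemma times_diff_cong:
  assumes "times_diff k I f" "open I" "\<And>s. s \<in> I \<Longrightarrow> f s = f2 s"
  shows "times_diff k I f2"
proof (cases k)
  case (Suc j)
  then obtain f' where "\<forall>s\<in>I. (f has_vector_derivative f' s) (at s)" "times_diff j I f'"
    using assms by auto
  then show ?thesis
    unfolding Suc using assms
    by (intro times_diff_SucI[of _ _ f']) (auto intro: has_vector_derivative_transform_within_open)
qed simp

lemma times_diff_add:
  "times_diff k I f \<Longrightarrow> times_diff k I f2 \<Longrightarrow> times_diff k I (\<lambda>s. f s + f2 s)"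
proof (induction k arbitrary: f f2)
  case (Suc k)
  then obtain f' f2' where "\<forall>s\<in>I. (f has_vector_derivative f' s) (at s)" "times_diff k I f'"
    "\<forall>s\<in>I. (f2 has_vector_derivative f2' s) (at s)" "times_diff k I f2'"
    by auto
  then show ?case
    by (intro times_diff_SucI[of _ _ "\<lambda>s. f' s + f2' s"]) (auto intro: has_vector_derivative_add Suc.IH)
qed simp

lemma times_diff_bounded_linear:
  assumes "bounded_linear L"
  shows "times_diff k I f \<Longrightarrow> times_diff k I (\<lambda>s. L (f s))"
proof (induction k arbitrary: f)
  case (Suc k)
  then obtain f' where "\<forall>s\<in>I. (f has_vector_derivative f' s) (at s)" "times_diff k I f'"
    by auto
  then show ?case
    by (intro times_diff_SucI[of _ _ "\<lambda>s. L (f' s)"])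
      (auto intro: bounded_linear.has_vector_derivative[OF assms] Suc.IH)
qed simp

lemma times_diff_bounded_bilinear:
  assumes "bounded_bilinear P"
  shows "times_diff k I f \<Longrightarrow> times_diff k I f2 \<Longrightarrow> times_diff k I (\<lambda>s. P (f s) (f2 s))"
proof (induction k arbitrary: f f2)
  case (Suc k)
  then obtain f' f2' where *: "\<forall>s\<in>I. (f has_vector_derivative f' s) (at s)" "times_diff k I f'"
    "\<forall>s\<in>I. (f2 has_vector_derivative f2' s) (at s)" "times_diff k I f2'"
    by auto
  moreover have "times_diff k I f" "times_diff k I f2"
    using Suc.prems times_diff_SucD by blast+
  ultimately have "times_diff k I (\<lambda>s. P (f s) (f2' s) + P (f' s) (f2 s))"
    by (intro times_diff_add Suc.IH)
  then show ?case
    using * by (intro times_diff_SucI) (auto intro: bounded_bilinear.has_vector_derivative[OF assms])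
qed simp

lemma times_diff_inverse:
  fixes f :: "real \<Rightarrow> real"
  assumes nz: "\<And>s. s \<in> I \<Longrightarrow> f s \<noteq> 0"
  shows "times_diff k I f \<Longrightarrow> times_diff k I (\<lambda>s. 1 / f s)"
proof (induction k)
  case (Suc k)
  then obtain f' where *: "\<forall>s\<in>I. (f has_vector_derivative f' s) (at s)" "times_diff k I f'"
    by auto
  \<comment> \<open>The derivative of \<open>1 / f\<close> involves \<open>1 / f\<close> itself, which the induction controls to one order less.\<close>
  have inv: "times_diff k I (\<lambda>s. 1 / f s)"
    using Suc times_diff_SucD by blast
  have "times_diff k I (\<lambda>s. - (f' s * ((1 / f s) * (1 / f s))))"
    by (intro times_diff_bounded_linear[OF bounded_linear_minus[OF bounded_linear_ident]]
        times_diff_bounded_bilinear[OF bounded_bilinear_mult] inv *)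
  moreover have "((\<lambda>s. 1 / f s) has_vector_derivative - (f' s * ((1 / f s) * (1 / f s)))) (at s)"
    if "s \<in> I" for s
    using * that nz[OF that] unfolding has_real_derivative_iff_has_vector_derivative[symmetric]
    by (auto intro!: derivative_eq_intros simp: field_simps)
  ultimately show ?case
    by (intro times_diff_SucI)
qed simp

lemma times_diff_sqrt:
  fixes f :: "real \<Rightarrow> real"
  assumes pos: "\<And>s. s \<in> I \<Longrightarrow> 0 < f s"
  shows "times_diff k I f \<Longrightarrow> times_diff k I (\<lambda>s. sqrt (f s))"
proof (induction k)
  case (Suc k)
  then obtain f' where *: "\<forall>s\<in>I. (f has_vector_derivative f' s) (at s)" "times_diff k I f'"
    by auto
  have nz: "sqrt (f s) \<noteq> 0" if "s \<in> I" for s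
    using pos[OF that] by simp
  have "times_diff k I (\<lambda>s. sqrt (f s))"
    using Suc times_diff_SucD by blast
  then have "times_diff k I (\<lambda>s. (1 / sqrt (f s)) * (f' s / 2))"
    by (intro times_diff_bounded_linear[OF bounded_linear_divide]
        times_diff_bounded_bilinear[OF bounded_bilinear_mult] times_diff_inverse nz *)
  moreover have "((\<lambda>s. sqrt (f s)) has_vector_derivative (1 / sqrt (f s)) * (f' s / 2)) (at s)"
    if "s \<in> I" for s
    using * that pos[OF that] unfolding has_real_derivative_iff_has_vector_derivative[symmetric]
    by (auto intro!: derivative_eq_intros simp: field_simps)
  ultimately show ?case
    by (intro times_diff_SucI)
qed simp

lemma times_diff_has_vector_derivative:
  assumes "times_diff (Suc k) I f" "s \<in> I"
  shows "(f has_vector_derivative vector_derivative f (at s)) (at s)"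
  using assms by (auto simp: vector_derivative_works[symmetric] differentiableI_vector)

lemma times_diff_vector_derivative:
  assumes "times_diff (Suc k) I f" "open I"
  shows "times_diff k I (\<lambda>s. vector_derivative f (at s))"
proof -
  obtain f' where "\<forall>s\<in>I. (f has_vector_derivative f' s) (at s)" "times_diff k I f'"
    using assms by auto
  then show ?thesis
    using assms(2) by (elim times_diff_cong) (auto intro!: vector_derivative_at[symmetric])
qed

lemma smooth_curve_on_times_diff:
  assumes "smooth_curve_on I \<alpha>"
  shows "times_diff k I \<alpha>"
proof -
  let ?D = "\<lambda>f t. vector_derivative f (at t)"
  have "times_diff k I ((?D ^^ n) \<alpha>)" for n
  proof (induction k arbitrary: n)
    case (Suc k)
    show ?case
    proof (rule times_diff_SucI[OF _ Suc.IH[of "Suc n"]])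
      show "((?D ^^ n) \<alpha> has_vector_derivative (?D ^^ Suc n) \<alpha> s) (at s)" if "s \<in> I" for s
        using assms that by (simp add: smooth_curve_on_def vector_derivative_works)
    qed
  qed simp
  from this[of 0] show ?thesis
    by simp
qed

section \<open>Matrices in \<open>SU(2)\<close> and its Lie algebra\<close>

lemma bilinear_matrix_mult: "bilinear ((**) :: cmat2 \<Rightarrow> cmat2 \<Rightarrow> cmat2)"
  unfolding bilinear_def
  by (auto intro!: linearI simp: matrix_add_ldistrib vec_eq_iff matrix_matrix_mult_def sum_2
      algebra_simps)

lemmas bounded_bilinear_matrix_mult =
  bilinear_matrix_mult[unfolded bilinear_conv_bounded_bilinear]

lemma linear_ctranspose: "linear ctranspose"
  by (auto intro!: linearI simp: ctranspose_def vec_eq_iff)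

lemmas bounded_linear_ctranspose = linear_ctranspose[unfolded linear_conv_bounded_linear]

lemma ctranspose_mult: "ctranspose (A ** B) = ctranspose B ** ctranspose A"
  by (simp add: ctranspose_def vec_eq_iff matrix_matrix_mult_def mult.commute)

lemma ctranspose_ctranspose [simp]: "ctranspose (ctranspose A) = A"
  by (simp add: ctranspose_def vec_eq_iff)

lemma mat_1_in_SU2: "mat 1 \<in> SU2"
proof -
  have "ctranspose (mat 1) = mat 1"
    by (simp add: ctranspose_def vec_eq_iff mat_def)
  then show ?thesis
    by (simp add: SU2_def det_I)
qed

lemma SU2_left_inverse: "p \<in> SU2 \<Longrightarrow> ctranspose p ** p = mat 1"
  by (simp add: SU2_def matrix_left_right_inverse)

text \<open>A unitary matrix of determinant one has its adjugate as conjugate transpose. These equations are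
  real linear, so velocities of curves in \<open>SU(2)\<close> inherit them.\<close>

lemma SU2_entries:
  assumes "p \<in> SU2"
  shows "p $ 2 $ 2 = cnj (p $ 1 $ 1)" "p $ 2 $ 1 = - cnj (p $ 1 $ 2)"
proof -
  have l: "ctranspose p ** p = mat 1" and d: "p $ 1 $ 1 * p $ 2 $ 2 - p $ 1 $ 2 * p $ 2 $ 1 = 1"
    using SU2_left_inverse[OF assms] assms by (simp_all add: SU2_def det_2)
  have r: "p ** ctranspose p = mat 1"
    using assms by (simp add: SU2_def)
  let ?a = "p $ 1 $ 1" and ?b = "p $ 1 $ 2" and ?c = "p $ 2 $ 1" and ?d = "p $ 2 $ 2"
  have e: "cnj ?a * ?a + cnj ?c * ?c = 1" "cnj ?a * ?b + cnj ?c * ?d = 0"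
     "cnj ?b * ?a + cnj ?d * ?c = 0" "cnj ?b * ?b + cnj ?d * ?d = 1"
    using l by (simp_all add: vec_eq_iff matrix_matrix_mult_def sum_2 ctranspose_def mat_def forall_2)
  have "?d = ?d * (cnj ?a * ?a + cnj ?c * ?c) - ?c * (cnj ?a * ?b + cnj ?c * ?d)"
    using e by simp
  also have "\<dots> = cnj ?a * (?a * ?d - ?b * ?c)"
    by (simp add: algebra_simps)
  finally show "?d = cnj ?a"
    using d by simp
  have "?c = ?c * (cnj ?b * ?b + cnj ?d * ?d) - ?d * (cnj ?b * ?a + cnj ?d * ?c)"
    using e by simp
  also have "\<dots> = - cnj ?b * (?a * ?d - ?b * ?c)"
    by (simp add: algebra_simps)
  finally show "?c = - cnj ?b"
    using d by simp
qed

lemma linear_trace: "linear (trace :: cmat2 \<Rightarrow> complex)"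
  by (auto intro!: linearI simp: trace_def sum_2 scaleR_add_right)

lemma subspace_su2: "subspace su2"
  unfolding su2_def
  by (rule subspaceI)
    (simp_all add: linear_0[OF linear_ctranspose] linear_add[OF linear_ctranspose]
      linear_scale[OF linear_ctranspose] linear_0[OF linear_trace] linear_add[OF linear_trace]
      linear_scale[OF linear_trace])

lemma su2_commutator:
  assumes "A \<in> su2" "B \<in> su2"
  shows "A ** B - B ** A \<in> su2"
proof -
  have "ctranspose (A ** B - B ** A) = - (A ** B - B ** A)"
    using assms
    by (simp add: su2_def linear_diff[OF linear_ctranspose] ctranspose_mult
        bilinear_lneg[OF bilinear_matrix_mult] bilinear_rneg[OF bilinear_matrix_mult])
  then show ?thesis
    by (simp add: su2_def trace_sub trace_mul_sym[of A B])
qed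

lemma dim_su2: "dim su2 \<le> 3"
proof -
  define e1 :: cmat2 where "e1 = vector [vector [\<i>, 0], vector [0, - \<i>]]"
  define e2 :: cmat2 where "e2 = vector [vector [0, 1], vector [- 1, 0]]"
  define e3 :: cmat2 where "e3 = vector [vector [0, \<i>], vector [\<i>, 0]]"
  have "A = Im (A $ 1 $ 1) *\<^sub>R e1 + Re (A $ 1 $ 2) *\<^sub>R e2 + Im (A $ 1 $ 2) *\<^sub>R e3"
    if "A \<in> su2" for A
  proof -
    have "cnj (A $ 1 $ 1) = - A $ 1 $ 1" "cnj (A $ 1 $ 2) = - A $ 2 $ 1" "A $ 2 $ 2 = - A $ 1 $ 1"
      using that
      by (auto simp: su2_def ctranspose_def vec_eq_iff trace_def sum_2 forall_2 add_eq_0_iff)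
    then show ?thesis
      by (simp add: vec_eq_iff forall_2 e1_def e2_def e3_def complex_eq_iff)
  qed
  moreover have "Im (A $ 1 $ 1) *\<^sub>R e1 + Re (A $ 1 $ 2) *\<^sub>R e2 + Im (A $ 1 $ 2) *\<^sub>R e3
      \<in> span {e1, e2, e3}" for A :: cmat2
    by (intro span_add span_scale span_base) auto
  ultimately have "su2 \<subseteq> span {e1, e2, e3}"
    by (metis subsetI)
  then have "dim su2 \<le> card {e1, e2, e3}"
    by (intro dim_le_card) auto
  also have "\<dots> \<le> 3"
    by (simp add: card_insert_if)
  finally show ?thesis .
qed

lemma subspace_tangent: "subspace (tangent_SU2 p)"
  unfolding tangent_SU2_def
  by (rule linear_subspace_image[OF _ subspace_su2])
    (use bilinear_matrix_mult in \<open>simp add: bilinear_def\<close>)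

text \<open>Differentiating \<open>\<alpha>\<^sup>* \<alpha> = 1\<close> makes \<open>\<alpha>\<^sup>* v\<close> skew-Hermitian, with purely imaginary diagonal. Instead of
  differentiating the determinant, the trace is found from the linear equations above, which make the two
  diagonal entries of \<open>\<alpha>\<^sup>* v\<close> conjugate to each other.\<close>

lemma velocity_tangent:
  assumes I: "open I" "s \<in> I" and inSU2: "\<And>r. r \<in> I \<Longrightarrow> \<alpha> r \<in> SU2"
    and d: "(\<alpha> has_vector_derivative v) (at s)"
  shows "ctranspose (\<alpha> s) ** v \<in> su2" and "v = \<alpha> s ** (ctranspose (\<alpha> s) ** v)"
proof -
  let ?A = "ctranspose (\<alpha> s) ** v"
  have "((\<lambda>r. ctranspose (\<alpha> r) ** \<alpha> r) has_vector_derivative ?A + ctranspose v ** \<alpha> s) (at s)"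
    by (rule bounded_bilinear.has_vector_derivative[OF bounded_bilinear_matrix_mult
          bounded_linear.has_vector_derivative[OF bounded_linear_ctranspose d] d])
  moreover have "((\<lambda>r. ctranspose (\<alpha> r) ** \<alpha> r) has_vector_derivative 0) (at s)"
    by (rule has_vector_derivative_transform_within_open[OF has_vector_derivative_const I])
      (simp add: SU2_left_inverse inSU2)
  ultimately have "?A + ctranspose v ** \<alpha> s = 0"
    by (rule vector_derivative_unique_at)
  then have skew: "ctranspose ?A = - ?A"
    by (simp add: ctranspose_mult add_eq_0_iff)
  define L :: "cmat2 \<Rightarrow> complex \<times> complex" where
    "L A = (A $ 2 $ 2 - cnj (A $ 1 $ 1), A $ 2 $ 1 + cnj (A $ 1 $ 2))" for A
  have "linear L"
    by (auto intro!: linearI simp: L_def algebra_simps)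
  then have "((\<lambda>r. L (\<alpha> r)) has_vector_derivative L v) (at s)"
    using bounded_linear.has_vector_derivative[OF _ d, of L] by (simp add: linear_conv_bounded_linear)
  moreover have "((\<lambda>r. L (\<alpha> r)) has_vector_derivative 0) (at s)"
    by (rule has_vector_derivative_transform_within_open[OF has_vector_derivative_const I])
      (simp add: L_def SU2_entries inSU2)
  ultimately have "L v = 0"
    by (rule vector_derivative_unique_at)
  then have v: "v $ 2 $ 2 = cnj (v $ 1 $ 1)" "v $ 2 $ 1 = - cnj (v $ 1 $ 2)"
    by (simp_all add: L_def zero_prod_def add_eq_0_iff)
  have "cnj (?A $ 1 $ 1) = ?A $ 2 $ 2"
    using v SU2_entries[OF inSU2[OF I(2)]]
    by (simp add: ctranspose_def matrix_matrix_mult_def sum_2 algebra_simps)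
  moreover have "cnj (?A $ 1 $ 1) = - ?A $ 1 $ 1"
    using arg_cong[OF skew, of "\<lambda>M. M $ 1 $ 1"] by (simp add: ctranspose_def)
  ultimately have "trace ?A = 0"
    by (simp add: trace_def sum_2 flip: \<open>cnj (?A $ 1 $ 1) = ?A $ 2 $ 2\<close>)
  then show "?A \<in> su2"
    using skew by (simp add: su2_def)
  show "v = \<alpha> s ** ?A"
    using inSU2[OF I(2)] by (simp add: matrix_mul_assoc SU2_def)
qed

section \<open>Coordinates in an orthonormal frame\<close>

lemma has_vector_derivative_components:
  fixes f :: "real \<Rightarrow> real ^ 'n"
  assumes "(f has_vector_derivative f') (at s)"
  shows "(\<chi> i. deriv (\<lambda>r. f r $ i) s) = f'"
proof -
  have "((\<lambda>r. f r $ i) has_real_derivative f' $ i) (at s)" for i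
    using bounded_linear.has_vector_derivative[OF bounded_linear_vec_nth assms]
    by (simp add: has_real_derivative_iff_has_vector_derivative)
  then show ?thesis
    by (simp add: vec_eq_iff DERIV_imp_deriv)
qed

locale lie_frame =
  fixes g :: metric and E :: "3 \<Rightarrow> vfield"
  assumes metric: "bi_invariant_metric g" and frame: "orthonormal_frame g E"
begin

definition comb :: "real ^ 3 \<Rightarrow> vfield" where
  "comb x p = (\<Sum>i\<in>UNIV. x $ i *\<^sub>R E i p)"

lemma frame_tangent: "p \<in> SU2 \<Longrightarrow> E i p \<in> tangent_SU2 p"
  using frame by (simp add: orthonormal_frame_def left_invariant_def)

lemma comb_tangent: "p \<in> SU2 \<Longrightarrow> comb x p \<in> tangent_SU2 p"
  unfolding comb_def
  by (intro subspace_sum subspace_tangent subspace_scale frame_tangent)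

lemma metric_linear_left:
  assumes "p \<in> SU2" "v \<in> tangent_SU2 p" "w \<in> tangent_SU2 p" "z \<in> tangent_SU2 p"
  shows "g p (a *\<^sub>R v + b *\<^sub>R w) z = a * g p v z + b * g p w z"
  using metric assms unfolding bi_invariant_metric_def by blast

lemma metric_commute:
  assumes "p \<in> SU2" "v \<in> tangent_SU2 p" "w \<in> tangent_SU2 p"
  shows "g p v w = g p w v"
  using metric assms unfolding bi_invariant_metric_def by blast

lemma metric_comb_left:
  assumes p: "p \<in> SU2" and z: "z \<in> tangent_SU2 p"
  shows "g p (comb x p) z = (\<Sum>i\<in>UNIV. x $ i * g p (E i p) z)"
proof -
  have "g p (\<Sum>i\<in>J. x $ i *\<^sub>R E i p) z = (\<Sum>i\<in>J. x $ i * g p (E i p) z)" if "finite J" for J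
    using that
  proof (induction J)
    case empty
    then show ?case
      using metric_linear_left[OF p z z z, of 0 0] by simp
  next
    case (insert j J)
    have "(\<Sum>i\<in>J. x $ i *\<^sub>R E i p) \<in> tangent_SU2 p"
      by (intro subspace_sum subspace_tangent subspace_scale frame_tangent p)
    then show ?case
      using insert metric_linear_left[OF p frame_tangent[OF p, of j] _ z, where a = "x $ j" and b = 1] by simp
  qed
  then show ?thesis
    by (simp add: comb_def)
qed

lemma metric_comb_frame:
  assumes p: "p \<in> SU2"
  shows "g p (comb x p) (E j p) = x $ j"
proof -
  have "g p (comb x p) (E j p) = (\<Sum>i\<in>UNIV. if i = j then x $ i else 0)"
    unfolding metric_comb_left[OF p frame_tangent[OF p]]
    using frame p by (intro sum.cong) (auto simp: orthonormal_frame_def)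
  then show ?thesis
    by simp
qed

lemma metric_comb:
  assumes p: "p \<in> SU2"
  shows "g p (comb x p) (comb y p) = x \<bullet> y"
proof -
  have "g p (E i p) (comb y p) = y $ i" for i
    using metric_commute[OF p frame_tangent[OF p] comb_tangent[OF p]] metric_comb_frame[OF p]
    by simp
  then show ?thesis
    by (simp add: metric_comb_left[OF p comb_tangent[OF p]] inner_vec_def)
qed

lemma left_invariant_at:
  assumes "left_invariant X" "p \<in> SU2"
  shows "X p = p ** X (mat 1)"
proof -
  have "X (p ** mat 1) = p ** X (mat 1)"
    using assms mat_1_in_SU2 unfolding left_invariant_def by blast
  then show ?thesis
    by simp
qed

lemma frame_at: "p \<in> SU2 \<Longrightarrow> E i p = p ** E i (mat 1)"
  using frame left_invariant_at by (simp add: orthonormal_frame_def)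

lemma linear_matrix_left: "linear (\<lambda>A :: cmat2. p ** A)" for p :: cmat2
  using bilinear_matrix_mult by (simp add: bilinear_def)

lemma comb_at: "p \<in> SU2 \<Longrightarrow> comb x p = p ** comb x (mat 1)"
  by (simp add: comb_def frame_at[of p] linear_sum[OF linear_matrix_left]
      linear_scale[OF linear_matrix_left])

lemma tangent_identity: "tangent_SU2 (mat 1) = su2"
  by (simp add: tangent_SU2_def)

lemma linear_comb: "linear (\<lambda>x. comb x p)"
  by (auto intro!: linearI simp: comb_def scaleR_add_left sum.distrib scaleR_sum_right)

lemma inj_comb: "inj (\<lambda>x. comb x (mat 1))"
proof -
  have "x = 0" if "comb x (mat 1) = 0" for x
    using metric_comb[OF mat_1_in_SU2, of x x] metric_comb[OF mat_1_in_SU2, of 0 x] that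
      linear_0[OF linear_comb[of "mat 1"]]
    by simp
  then show ?thesis
    by (simp add: linear_injective_0[OF linear_comb])
qed

text \<open>Orthonormality only makes the three fields linearly independent. Counting dimensions in \<open>su(2)\<close>
  shows that they span the tangent space at the identity, and by left translation every tangent space.\<close>

lemma range_comb: "range (\<lambda>x. comb x (mat 1)) = su2"
proof (rule subspace_dim_equal)
  show "subspace (range (\<lambda>x. comb x (mat 1)))"
    by (intro linear_subspace_image linear_comb subspace_UNIV)
  show "range (\<lambda>x. comb x (mat 1)) \<subseteq> su2"
    using comb_tangent[OF mat_1_in_SU2] tangent_identity by auto
  have "dim (range (\<lambda>x. comb x (mat 1))) = 3"
    using dim_image_eq[OF linear_comb, of "mat 1" UNIV] inj_comb by simp
  then show "dim su2 \<le> dim (range (\<lambda>x. comb x (mat 1)))"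
    using dim_su2 by simp
qed (rule subspace_su2)

text \<open>The metric is linear only on tangent vectors, so the coordinate map on \<open>su(2)\<close> is not visibly the
  restriction of a linear map on all matrices. Such an extension is what lets smoothness of a curve of
  matrices pass to coordinates.\<close>

lemma exists_linear_coords:
  "\<exists>L. linear L \<and> (\<forall>A\<in>su2. \<forall>p\<in>SU2. comb (L A) p = p ** A)"
proof -
  obtain L where L: "linear L" "L \<circ> (\<lambda>x. comb x (mat 1)) = id"
    using linear_injective_left_inverse[OF linear_comb inj_comb] by blast
  have "comb (L A) p = p ** A" if "A \<in> su2" "p \<in> SU2" for A p
  proof -
    have "A \<in> range (\<lambda>x. comb x (mat 1))"
      using that(1) range_comb by simp
    then obtain x where x: "A = comb x (mat 1)"
      by (rule rangeE)
    then have "L A = x"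
      using fun_cong[OF L(2), of x] by simp
    then show ?thesis
      using comb_at[OF that(2), of x] x by simp
  qed
  with L(1) show ?thesis
    by blast
qed

lemma left_invariant_comb: "left_invariant (\<lambda>p. p ** comb d (mat 1))"
  unfolding left_invariant_def
  using comb_tangent[OF mat_1_in_SU2] tangent_identity
  by (auto simp: matrix_mul_assoc tangent_SU2_def)

lemma left_invariant_coords:
  assumes X: "left_invariant X"
  shows "\<exists>d. \<forall>p\<in>SU2. X p = comb d p"
proof -
  have "X (mat 1) \<in> su2"
    using X mat_1_in_SU2 tangent_identity by (auto simp: left_invariant_def)
  then obtain d where "X (mat 1) = comb d (mat 1)"
    using range_comb by blast
  then have "\<forall>p\<in>SU2. X p = comb d p"
    by (simp add: left_invariant_at[OF X] comb_at[of _ d])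
  then show ?thesis
    by blast
qed

lemma coords_comb: "\<alpha> s \<in> SU2 \<Longrightarrow> W s = comb x (\<alpha> s) \<Longrightarrow> coords g E \<alpha> W s = x"
  by (simp add: coords_def metric_comb_frame)

lemma dot_along_comb:
  assumes "(coords g E \<alpha> W has_vector_derivative w') (at s)"
  shows "dot_along g E \<alpha> W s = comb w' (\<alpha> s)"
  using has_vector_derivative_components[OF assms, symmetric] by (simp add: dot_along_def comb_def)

lemma cross_along_comb:
  "cross_along g E \<alpha> V W s = comb (cross3 (coords g E \<alpha> V s) (coords g E \<alpha> W s)) (\<alpha> s)"
  by (simp add: cross_along_def comb_def)

lemma bracket_along_tangent:
  assumes "\<alpha> s \<in> SU2"
  shows "bracket_along g E \<alpha> V W s \<in> tangent_SU2 (\<alpha> s)"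
proof -
  have "E i (mat 1) \<in> su2" for i
    using frame_tangent[OF mat_1_in_SU2] tangent_identity by simp
  then have "lie_bracket (E i) (E j) (\<alpha> s) \<in> tangent_SU2 (\<alpha> s)" for i j
    by (simp add: lie_bracket_def tangent_SU2_def su2_commutator)
  then show ?thesis
    unfolding bracket_along_def
    by (intro subspace_sum subspace_tangent subspace_scale)
qed

lemma bracket_along_self: "bracket_along g E \<alpha> V V s = 0"
proof -
  let ?c = "\<lambda>i. coords g E \<alpha> V s $ i"
  let ?B = "\<lambda>i j. lie_bracket (E i) (E j) (\<alpha> s)"
  have "?B j i = - ?B i j" for i j
    unfolding lie_bracket_def by (simp flip: linear_neg[OF linear_matrix_left])
  then have antisym: "(?c j * ?c i) *\<^sub>R ?B j i = - ((?c i * ?c j) *\<^sub>R ?B i j)" for i j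
    by (metis mult.commute scaleR_minus_right)
  have "bracket_along g E \<alpha> V V s = (\<Sum>i\<in>UNIV. \<Sum>j\<in>UNIV. (?c j * ?c i) *\<^sub>R ?B j i)"
    unfolding bracket_along_def by (rule sum.swap)
  also have "\<dots> = (\<Sum>i\<in>UNIV. \<Sum>j\<in>UNIV. - ((?c i * ?c j) *\<^sub>R ?B i j))"
    by (intro sum.cong refl antisym)
  also have "\<dots> = - bracket_along g E \<alpha> V V s"
    by (simp add: bracket_along_def sum_negf)
  finally have "2 *\<^sub>R bracket_along g E \<alpha> V V s = 0"
    by (simp only: scaleR_2 eq_neg_iff_add_eq_0)
  then show ?thesis
    by (simp only: scaleR_eq_0_iff) simp
qed

end

section \<open>Slant helices in \<open>SU(2)\<close>\<close>

theorem corollary3p9: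
  fixes g :: metric and E :: "3 \<Rightarrow> vfield" and I :: "real set" and \<alpha> :: "real \<Rightarrow> cmat2"
  assumes "bi_invariant_metric g"
    and "orthonormal_frame g E"
    and "open I" and "is_interval I" and "I \<noteq> {}"
    and "unit_speed_curve g I \<alpha>"
    and "\<forall>s\<in>I. 0 < curvature g E \<alpha> s"
    and "\<forall>s\<in>I. tau_G g E \<alpha> s = 1"
  shows "slant_helix g E I \<alpha> \<longleftrightarrow>
    ((\<forall>s\<in>I. deriv (harmonic g E \<alpha>) s \<noteq> 0) \<and> (\<exists>c. \<forall>s\<in>I. sigma_N g E \<alpha> s = c))"
proof -
  interpret lie_frame g E
    by (rule lie_frame.intro) fact+
  note I = \<open>open I\<close>
  have \<alpha>: "\<alpha> s \<in> SU2" and unit: "g (\<alpha> s) (Tan \<alpha> s) (Tan \<alpha> s) = 1" if "s \<in> I" for s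
    using assms(6) that by (simp_all add: unit_speed_curve_def)
  have smooth_\<alpha>: "times_diff m I \<alpha>" for m
    using assms(6) by (simp add: unit_speed_curve_def smooth_curve_on_times_diff)
  have k_pos: "0 < curvature g E \<alpha> s" if "s \<in> I" for s
    using assms(7) that by blast
  have tau_G: "tau_G g E \<alpha> s = 1" if "s \<in> I" for s
    using assms(8) that by blast
  define u where "u = coords g E \<alpha> (Tan \<alpha>)"
  define u' where "u' s = vector_derivative u (at s)" for s
  define k where "k = curvature g E \<alpha>"
  define n where "n = coords g E \<alpha> (Nor g E \<alpha>)"
  define n' where "n' s = vector_derivative n (at s)" for s
  define b where "b s = cross3 (u s) (n s)" for s
  define t where "t s = torsion g E \<alpha> s - 1" for s

  obtain L where L: "linear L" "\<And>A p. A \<in> su2 \<Longrightarrow> p \<in> SU2 \<Longrightarrow> comb (L A) p = p ** A"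
    using exists_linear_coords by blast
  \<comment> \<open>Left translating the velocity back to the identity exhibits \<open>u\<close> as a smooth function.\<close>
  have T: "Tan \<alpha> s = comb (L (ctranspose (\<alpha> s) ** Tan \<alpha> s)) (\<alpha> s)" if s: "s \<in> I" for s
  proof -
    have "(\<alpha> has_vector_derivative Tan \<alpha> s) (at s)"
      using times_diff_has_vector_derivative[OF smooth_\<alpha> s] by (simp add: Tan_def)
    from velocity_tangent[OF I s \<alpha> this] show ?thesis
      using L(2) \<alpha>[OF s] by simp
  qed
  have u_eq: "u s = L (ctranspose (\<alpha> s) ** Tan \<alpha> s)" if "s \<in> I" for s
    unfolding u_def by (intro coords_comb \<alpha> T that)
  have T_comb: "Tan \<alpha> s = comb (u s) (\<alpha> s)" if "s \<in> I" for s
    using T u_eq that by simp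
  have smooth_u: "times_diff m I u" for m
  proof -
    have "times_diff m I (\<lambda>s. L (ctranspose (\<alpha> s) ** Tan \<alpha> s))"
      using L(1) times_diff_vector_derivative[OF smooth_\<alpha> I] unfolding Tan_def
      by (intro times_diff_bounded_linear[of L] times_diff_bounded_linear[OF bounded_linear_ctranspose]
          times_diff_bounded_bilinear[OF bounded_bilinear_matrix_mult] smooth_\<alpha>)
        (simp_all add: linear_conv_bounded_linear)
    then show ?thesis
      by (rule times_diff_cong) (simp_all add: I u_eq)
  qed
  have smooth_u': "times_diff m I u'" for m
    using times_diff_vector_derivative[OF smooth_u I] by (simp add: u'_def[abs_def])
  have du: "(u has_vector_derivative u' s) (at s)" if "s \<in> I" for s
    using times_diff_has_vector_derivative[OF smooth_u that] by (simp add: u'_def)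
  have uu: "u s \<bullet> u s = 1" if "s \<in> I" for s
    using unit[OF that] by (simp add: T_comb that metric_comb \<alpha>)
  have dot_T: "dot_along g E \<alpha> (Tan \<alpha>) s = comb (u' s) (\<alpha> s)" if "s \<in> I" for s
    using dot_along_comb du[OF that] by (simp add: u_def)
  have k_eq: "k s = sqrt (u' s \<bullet> u' s)" if "s \<in> I" for s
    by (simp add: k_def curvature_def dot_T that metric_comb \<alpha>)
  have k_nz: "k s \<noteq> 0" if "s \<in> I" for s
    using k_pos[OF that] by (simp add: k_def)
  have smooth_k: "times_diff m I k" for m
  proof -
    have "0 < u' s \<bullet> u' s" if "s \<in> I" for s
      using k_pos[OF that] k_eq[OF that] by (simp add: k_def)
    then have "times_diff m I (\<lambda>s. sqrt (u' s \<bullet> u' s))"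
      by (intro times_diff_sqrt times_diff_bounded_bilinear[OF bounded_bilinear_inner] smooth_u')
    then show ?thesis
      by (rule times_diff_cong) (simp_all add: I k_eq)
  qed
  have N_comb': "Nor g E \<alpha> s = comb ((1 / k s) *\<^sub>R u' s) (\<alpha> s)" if "s \<in> I" for s
    by (simp add: Nor_def cov_deriv_def bracket_along_self dot_T that k_def
        linear_scale[OF linear_comb])
  have n_eq: "n s = (1 / k s) *\<^sub>R u' s" if "s \<in> I" for s
    unfolding n_def by (intro coords_comb \<alpha> N_comb' that)
  have N_comb: "Nor g E \<alpha> s = comb (n s) (\<alpha> s)" if "s \<in> I" for s
    using N_comb' n_eq that by simp
  have smooth_n: "times_diff m I n" for m
  proof -
    have "times_diff m I (\<lambda>s. (1 / k s) *\<^sub>R u' s)"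
      by (intro times_diff_bounded_bilinear[OF bounded_bilinear_scaleR] times_diff_inverse
          smooth_k smooth_u' k_nz)
    then show ?thesis
      by (rule times_diff_cong) (simp_all add: I n_eq)
  qed
  have dn: "(n has_vector_derivative n' s) (at s)" if "s \<in> I" for s
    using times_diff_has_vector_derivative[OF smooth_n that] by (simp add: n'_def)
  have u'_eq: "u' s = k s *\<^sub>R n s" if "s \<in> I" for s
    using n_eq k_nz that by simp
  have nn: "n s \<bullet> n s = 1" if s: "s \<in> I" for s
  proof -
    have "u' s \<bullet> u' s = k s * k s"
      by (simp add: k_eq[OF s])
    then show ?thesis
      using k_nz[OF s] by (simp add: n_eq[OF s])
  qed
  have const_inner: "v s \<bullet> w' + v' \<bullet> w s = 0"
    if "s \<in> I" "(v has_vector_derivative v') (at s)" "(w has_vector_derivative w') (at s)"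
      "\<And>r. r \<in> I \<Longrightarrow> v r \<bullet> w r = c" for v w :: "real \<Rightarrow> real ^ 3" and v' w' s c
  proof -
    have "((\<lambda>r. v r \<bullet> w r) has_vector_derivative 0) (at s)"
      by (rule has_vector_derivative_transform_within_open[OF has_vector_derivative_const I that(1)])
        (simp add: that(4))
    with bounded_bilinear.has_vector_derivative[OF bounded_bilinear_inner that(2,3)] show ?thesis
      by (rule vector_derivative_unique_at)
  qed
  have un: "u s \<bullet> n s = 0" if s: "s \<in> I" for s
    using const_inner[OF s du[OF s] du[OF s] uu] k_nz[OF s]
    by (simp add: u'_eq[OF s] inner_commute)
  have B_comb: "Bin g E \<alpha> s = comb (b s) (\<alpha> s)" for s
    by (simp add: Bin_def cross_along_comb b_def u_def n_def)
  \<comment> \<open>The bracket term of the covariant derivative contributes \<open>\<tau>\<^sub>G = 1\<close> to the torsion, so \<open>t\<close> is the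
     torsion that the coordinate curve has in flat space.\<close>
  have t_eq: "t s = n' s \<bullet> b s" if s: "s \<in> I" for s
  proof -
    have "dot_along g E \<alpha> (Nor g E \<alpha>) s = comb (n' s) (\<alpha> s)"
      using dot_along_comb dn[OF s] by (simp add: n_def)
    moreover have "bracket_along g E \<alpha> (Tan \<alpha>) (Nor g E \<alpha>) s \<in> tangent_SU2 (\<alpha> s)"
      by (intro bracket_along_tangent \<alpha> s)
    ultimately have "torsion g E \<alpha> s = n' s \<bullet> b s + tau_G g E \<alpha> s"
      using metric_linear_left[OF \<alpha>[OF s] comb_tangent[OF \<alpha>[OF s], of "n' s"] _
          comb_tangent[OF \<alpha>[OF s], of "b s"], where a = 1 and b = "1/2"]
      by (simp add: torsion_def cov_deriv_def tau_G_def B_comb metric_comb \<alpha>[OF s])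
    then show ?thesis
      using tau_G[OF s] by (simp add: t_def)
  qed
  have n'_eq: "n' s = t s *\<^sub>R b s - k s *\<^sub>R u s" if s: "s \<in> I" for s
  proof -
    have "n' s \<bullet> n s = 0"
      using const_inner[OF s dn[OF s] dn[OF s] nn] by (simp add: inner_commute)
    moreover have "n' s \<bullet> u s = - k s"
      using const_inner[OF s du[OF s] dn[OF s] un] nn[OF s]
      by (simp add: u'_eq[OF s] inner_commute)
    ultimately show ?thesis
      using orthonormal_expansion_R3[OF uu[OF s] nn[OF s] un[OF s], of "n' s"]
      by (simp add: t_eq[OF s] b_def)
  qed
  have smooth_ratio: "times_diff m I (harmonic g E \<alpha>)" for m
  proof -
    have "times_diff m I n'"
      using times_diff_vector_derivative[OF smooth_n I] by (simp add: n'_def[abs_def])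
    then have "times_diff m I (\<lambda>s. (1 / k s) * (n' s \<bullet> b s))"
      unfolding b_def
      by (intro times_diff_bounded_bilinear[OF bounded_bilinear_mult] times_diff_inverse smooth_k k_nz
          times_diff_bounded_bilinear[OF bounded_bilinear_inner]
          times_diff_bounded_bilinear[OF bounded_bilinear_cross3] smooth_u smooth_n)
    then show ?thesis
      by (rule times_diff_cong) (simp_all add: I harmonic_def k_def flip: t_eq t_def)
  qed

  interpret frenet_curve I u n b k t "deriv (harmonic g E \<alpha>)"
  proof
    fix s assume s: "s \<in> I"
    have "(harmonic g E \<alpha> has_real_derivative deriv (harmonic g E \<alpha>) s) (at s)"
      using times_diff_has_vector_derivative[OF smooth_ratio s]
      by (metis DERIV_imp_deriv has_real_derivative_iff_has_vector_derivative)
    then show "((\<lambda>s. t s / k s) has_real_derivative deriv (harmonic g E \<alpha>) s) (at s)"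
      by (simp add: harmonic_def[abs_def] t_def k_def)
    show "(u has_vector_derivative k s *\<^sub>R n s) (at s)"
      using du[OF s] u'_eq[OF s] by simp
    show "(n has_vector_derivative t s *\<^sub>R b s - k s *\<^sub>R u s) (at s)"
      using dn[OF s] n'_eq[OF s] by simp
  qed (use assms uu nn un k_pos in \<open>simp_all add: b_def k_def\<close>)
  have sigma: "sigma = sigma_N g E \<alpha>"
    unfolding fun_eq_iff sigma_def by (simp add: sigma_N_def k_def t_def)

  show ?thesis
  proof
    assume "slant_helix g E I \<alpha>"
    then obtain X \<theta> where X: "left_invariant X" and \<theta>: "0 \<le> \<theta>" "\<theta> \<le> pi" "\<theta> \<noteq> pi / 2"
      and N: "\<And>s. s \<in> I \<Longrightarrow> g (\<alpha> s) (Nor g E \<alpha> s) (X (\<alpha> s)) = cos \<theta>"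
      unfolding slant_helix_def by blast
    obtain d where d: "\<And>p. p \<in> SU2 \<Longrightarrow> X p = comb d p"
      using left_invariant_coords[OF X] by blast
    have "n s \<bullet> d = cos \<theta>" if "s \<in> I" for s
      using N[OF that] by (simp add: N_comb that d \<alpha> metric_comb)
    moreover have "cos \<theta> \<noteq> 0"
      using \<theta> cos_inj_pi[of \<theta> "pi / 2"] by auto
    ultimately show "(\<forall>s\<in>I. deriv (harmonic g E \<alpha>) s \<noteq> 0) \<and> (\<exists>c. \<forall>s\<in>I. sigma_N g E \<alpha> s = c)"
      using sigma_const_if_slant[of "cos \<theta>" d] sigma by simp
  next
    assume "(\<forall>s\<in>I. deriv (harmonic g E \<alpha>) s \<noteq> 0) \<and> (\<exists>c. \<forall>s\<in>I. sigma_N g E \<alpha> s = c)"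
    then obtain m where "\<And>s. s \<in> I \<Longrightarrow> deriv (harmonic g E \<alpha>) s \<noteq> 0" "\<And>s. s \<in> I \<Longrightarrow> sigma s = m"
      unfolding sigma by blast
    \<comment> \<open>The axis comes with \<open>c > 0\<close>, so the angle \<open>arccos c\<close> is acute.\<close>
    from slant_if_sigma_const[OF this]
    obtain d c where d: "norm d = 1" "0 < c" "c \<le> 1" "\<And>s. s \<in> I \<Longrightarrow> n s \<bullet> d = c"
      by blast
    define X :: vfield where "X p = p ** comb d (mat 1)" for p
    have X: "X p = comb d p" if "p \<in> SU2" for p
      using comb_at[OF that] by (simp add: X_def)
    have "cos (arccos c) = c" "0 \<le> arccos c" "arccos c \<le> pi"
      using d(2,3) by (simp_all add: arccos_lbound arccos_ubound)
    moreover from this(1) have "arccos c \<noteq> pi / 2"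
      using d(2) cos_pi_half by force
    moreover have "left_invariant X"
      using left_invariant_comb by (simp add: X_def[abs_def])
    moreover have "g p (X p) (X p) = 1" if "p \<in> SU2" for p
      using d(1) by (simp add: X that metric_comb norm_eq_1)
    moreover have "g (\<alpha> s) (Nor g E \<alpha> s) (X (\<alpha> s)) = c" if "s \<in> I" for s
      using d(4)[OF that] by (simp add: N_comb that X \<alpha> metric_comb)
    ultimately show "slant_helix g E I \<alpha>"
      unfolding slant_helix_def by (intro exI[of _ X] exI[of _ "arccos c"]) auto
  qed
qed

end
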